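(* Let $n$ be a non-negative integer and let $q,a,b$ be non-zero complex numbers, with $\sqrt a$ a fixed square root of $a$, such that no denominator on either side below vanishes. Then $${}_4\phi_3\left[\begin{matrix} a,\ -q\sqrt a,\ b,\ q^{-n}\\ -\sqrt a,\ aq/b,\ aq^{n+1}\end{matrix};q,\frac{q^{n+1}\sqrt a}{b}\right]=\frac{(aq,\,q\sqrt a/b;q)_n}{(q\sqrt a,\,aq/b;q)_n} .$$
   Context: For complex $a,q$ and a non-negative integer $n$, $(a;q)_n:=\prod_{k=0}^{n-1}(1-aq^k)$, with $(a;q)_0=1$, and $(a_1,\ldots,a_k;q)_n:=\prod_{i=1}^k (a_i;q)_n$. The unilateral basic hypergeometric series is $${}_{r+1}\phi_r\left[\begin{matrix} a_0,\ldots,a_r\\ b_1,\ldots,b_r\end{matrix};q,z\right]:=\sum_{j=0}^{\infty}\frac{(a_0,\ldots,a_r;q)_j}{(q,b_1,\ldots,b_r;q)_j}z^j .$$ When one numerator parameter is $q^{-n}$ the series terminates and is read as the finite sum over $0\le j\le n$ (so no convergence condition on $z$ is needed). *)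

theory Defs
  imports Complex_Main
begin

definition qpoch :: "complex \<Rightarrow> complex \<Rightarrow> nat \<Rightarrow> complex" where
  "qpoch a q n = (\<Prod>k<n. 1 - a * q ^ k)"

definition qpochs :: "complex list \<Rightarrow> complex \<Rightarrow> nat \<Rightarrow> complex" where
  "qpochs as q n = (\<Prod>a\<leftarrow>as. qpoch a q n)"

text \<open>
  The series with numerator parameters \<open>as = [a\<^sub>0, \<dots>, a\<^sub>r]\<close> and denominator parameters
  \<open>bs = [b\<^sub>1, \<dots>, b\<^sub>r]\<close>.  The formula has no balancing factor, so it agrees with the
  usual series only when \<open>length as = length bs + 1\<close>.  If some numerator parameter is
  \<open>q\<^sup>-\<^sup>n\<close>, the terms with index above \<open>n\<close> have numerator 0, hence are 0 in HOL whatever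
  the denominator is, and the infinite sum is the finite sum over \<open>0 \<le> j \<le> n\<close>;
  see \<open>bhyp_terminating\<close>.
\<close>

definition bhyp :: "complex list \<Rightarrow> complex list \<Rightarrow> complex \<Rightarrow> complex \<Rightarrow> complex" where
  "bhyp as bs q z = (\<Sum>j. qpochs as q j / qpochs (q # bs) q j * z ^ j)"

lemma qpoch_eq_0_terminating:
  assumes "q \<noteq> 0" and "n < j"
  shows "qpoch (q powi (- int n)) q j = 0"
proof -
  have "1 - q powi (- int n) * q ^ n = 0"
    using assms(1) by (simp add: power_int_minus)
  then show ?thesis
    unfolding qpoch_def using assms(2) by (intro prod_zero) auto
qed

lemma bhyp_terminating:
  assumes "q \<noteq> 0" and "q powi (- int n) \<in> set as"
  shows "bhyp as bs q z = (\<Sum>j\<le>n. qpochs as q j / qpochs (q # bs) q j * z ^ j)"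
  unfolding bhyp_def
proof (rule suminf_finite)
  fix j assume "j \<notin> {..n}"
  then have "qpoch (q powi (- int n)) q j = 0"
    using assms(1) by (intro qpoch_eq_0_terminating) auto
  then have "qpochs as q j = 0"
    unfolding qpochs_def prod_list_zero_iff using assms(2) by force
  then show "qpochs as q j / qpochs (q # bs) q j * z ^ j = 0" by simp
qed simp

end

theory Submission imports Defs begin

text \<open>
  The series is the very-well-poised \<open>\<^sub>6\<phi>\<^sub>5\<close> series with parameters \<open>a, b, c, d\<close> at \<open>c = \<surd>a\<close> and
  \<open>d = q\<^sup>-\<^sup>n\<close>: for this \<open>c\<close> the parameters \<open>q\<surd>a, c\<close> cancel against \<open>\<surd>a, aq/c\<close>.  Write \<open>s = \<surd>a\<close>
  and let \<open>t\<^sub>j(s, b, d)\<close> be the \<open>j\<close>-th term for arbitrary \<open>d\<close>.  The term is not a difference in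
  closed form, but it becomes one after subtracting a term whose parameters are all shifted by
  one step:
  \<open>t\<^sub>j\<^sub>+\<^sub>1(s, b, d) = v\<^sub>j\<^sub>+\<^sub>1 - v\<^sub>j + C t\<^sub>j(sq, bq, dq)\<close>,
  where \<open>v\<close> (\<open>antidiff\<close>) is a product of shifted factorials and \<open>C\<close> (\<open>shift_factor\<close>) does not
  depend on \<open>j\<close> (lemma \<open>summand_Suc\<close>).

  Summing over \<open>j\<close> leaves the boundary value \<open>v\<^sub>n\<close>, which vanishes for \<open>d = q\<^sup>-\<^sup>n\<close> and \<open>n \<ge> 1\<close>
  because it contains the factor \<open>(dq;q)\<^sub>n\<close>.  As \<open>dq = q\<^sup>1\<^sup>-\<^sup>n\<close>, the sum of length \<open>n\<close> at \<open>(s, b)\<close> is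
  \<open>C\<close> times the sum of length \<open>n - 1\<close> at \<open>(sq, bq)\<close>, and the product side satisfies the same
  recurrence.

  The shift \<open>a \<mapsto> aq\<^sup>2\<close> is what lets an induction on \<open>n\<close> work under exactly the given
  nonvanishing conditions: the factors of \<open>(aq\<^sup>n\<^sup>+\<^sup>1;q)\<^sub>n\<close> then include those of the shorter sum.
  An induction with \<open>a\<close> fixed would also need \<open>aq\<^sup>n \<noteq> 1\<close>, and so on down to \<open>aq\<^sup>2 \<noteq> 1\<close>.
\<close>

lemma qpoch_0 [simp]: "qpoch a q 0 = 1"
  by (simp add: qpoch_def)

lemma qpoch_Suc: "qpoch a q (Suc n) = qpoch a q n * (1 - a * q ^ n)"
  by (simp add: qpoch_def)

lemma qpoch_Suc_shift: "qpoch a q (Suc n) = (1 - a) * qpoch (a * q) q n"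
  by (simp add: qpoch_def prod.lessThan_Suc_shift mult.assoc del: prod.lessThan_Suc)

lemma qpoch_nonzero_le:
  assumes "qpoch a q n \<noteq> 0" "m \<le> n"
  shows "qpoch a q m \<noteq> 0"
  using assms by (auto simp: qpoch_def)

definition summand :: "complex \<Rightarrow> complex \<Rightarrow> complex \<Rightarrow> complex \<Rightarrow> nat \<Rightarrow> complex" where
  "summand q s b d j =
     qpoch (s\<^sup>2) q j * qpoch (- q * s) q j * qpoch b q j * qpoch d q j
     / (qpoch q q j * qpoch (- s) q j * qpoch (s\<^sup>2 * q / b) q j * qpoch (s\<^sup>2 * q / d) q j)
     * (q * s / (b * d)) ^ j"

text \<open>
  This is \<open>summand\<close> times \<open>q\<^sup>-\<^sup>j(1 - ax)(1 - bx)(1 - dx)/(1 + sx)\<close> at \<open>x = q\<^sup>j\<close>, normalized to the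
  value 1 at \<open>j = 0\<close>.  The normalization divides out \<open>(1 - s)(1 - b)(1 - d)\<close>, so that
  the telescoping relation stays valid when one of \<open>s, b, d\<close> is 1.
\<close>

definition antidiff :: "complex \<Rightarrow> complex \<Rightarrow> complex \<Rightarrow> complex \<Rightarrow> nat \<Rightarrow> complex" where
  "antidiff q s b d j =
     qpoch (s\<^sup>2 * q) q j * qpoch (b * q) q j * qpoch (d * q) q j
     / (qpoch q q j * qpoch (s\<^sup>2 * q / b) q j * qpoch (s\<^sup>2 * q / d) q j)
     * (s / (b * d)) ^ j"

definition shift_factor :: "complex \<Rightarrow> complex \<Rightarrow> complex \<Rightarrow> complex \<Rightarrow> complex" where
  "shift_factor q s b d =
     (1 - s\<^sup>2 * q) * (1 + s * q) * (1 - s / (b * d))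
     / ((1 - s\<^sup>2 * q / b) * (1 - s\<^sup>2 * q / d))"

text \<open>
  The product telescopes.  The factor \<open>1 + s\<close> stays on the left because it may vanish when
  \<open>m = 0\<close>.
\<close>

lemma qpoch_ratio:
  assumes "qpoch (- s) q m \<noteq> 0"
  shows "(1 + s) * (qpoch (- q * s) q m / qpoch (- s) q m) = 1 + s * q ^ m"
proof -
  have "(1 + s) * qpoch (- q * s) q m = qpoch (- s) q m * (1 + s * q ^ m)"
    using qpoch_Suc[of "- s" q m] qpoch_Suc_shift[of "- s" q m] by (simp add: mult.commute)
  with assms show ?thesis by (simp add: field_simps)
qed

text \<open>
  After removal of the common factors, \<open>summand_Suc\<close> is this identity between polynomials
  in \<open>x = q\<^sup>j\<^sup>+\<^sup>1\<close>, with \<open>w = s/(bd)\<close>.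
\<close>

lemma telescoping_identity:
  fixes s b d w x :: complex
  assumes "b \<noteq> 0" "d \<noteq> 0" and w: "w = s / (b * d)"
  shows "(1 - s) * (1 - b) * (1 - d) * (1 + s * x) * (w * x)
       = (1 - s\<^sup>2 * x) * (1 - b * x) * (1 - d * x) * w
         - (1 - x) * (1 - s\<^sup>2 * x / b) * (1 - s\<^sup>2 * x / d)
         + (1 - x) * (1 - s\<^sup>2 * x) * (1 + s * x) * (1 - w)"
  using assms(1,2) unfolding w by (simp add: field_simps power2_eq_square)

lemma summand_Suc:
  assumes nz: "q \<noteq> 0" "b \<noteq> 0" "d \<noteq> 0"
    and Q: "qpoch q q (Suc m) \<noteq> 0" and S: "qpoch (- s) q (Suc m) \<noteq> 0"
    and B: "qpoch (s\<^sup>2 * q / b) q (Suc m) \<noteq> 0" and D: "qpoch (s\<^sup>2 * q / d) q (Suc m) \<noteq> 0"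
  shows "summand q s b d (Suc m) = antidiff q s b d (Suc m) - antidiff q s b d m
           + shift_factor q s b d * summand q (s * q) (b * q) (d * q) m"
proof -
  define w x where "w = s / (b * d)" and "x = q ^ Suc m"
  define N where "N = qpoch (s\<^sup>2 * q) q m * qpoch (b * q) q m * qpoch (d * q) q m"
  define E where "E = qpoch (s\<^sup>2 * q / b * q) q m"
  define F where "F = qpoch (s\<^sup>2 * q / d * q) q m"
  define M where "M = qpoch q q (Suc m) * ((1 - s\<^sup>2 * q / b) * E) * ((1 - s\<^sup>2 * q / d) * F)"
  define K where "K = N * w ^ m / M"
  have Bl: "qpoch (s\<^sup>2 * q / b) q (Suc m) = (1 - s\<^sup>2 * q / b) * E"
    and Dl: "qpoch (s\<^sup>2 * q / d) q (Suc m) = (1 - s\<^sup>2 * q / d) * F"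
    by (simp_all only: qpoch_Suc_shift E_def F_def)
  have Br: "qpoch (s\<^sup>2 * q / b) q (Suc m) = qpoch (s\<^sup>2 * q / b) q m * (1 - s\<^sup>2 * x / b)"
    and Dr: "qpoch (s\<^sup>2 * q / d) q (Suc m) = qpoch (s\<^sup>2 * q / d) q m * (1 - s\<^sup>2 * x / d)"
    and Qr: "qpoch q q (Suc m) = qpoch q q m * (1 - x)"
    by (simp_all add: qpoch_Suc x_def)
  have M: "M = qpoch q q (Suc m) * qpoch (s\<^sup>2 * q / b) q (Suc m) * qpoch (s\<^sup>2 * q / d) q (Suc m)"
    by (simp add: M_def Bl Dl)
  have Snz: "1 + s \<noteq> 0" "qpoch (- (s * q)) q m \<noteq> 0"
    using S by (simp_all add: qpoch_Suc_shift)

  have antidiff_Suc: "antidiff q s b d (Suc m) =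
      K * ((1 - s\<^sup>2 * x) * (1 - b * x) * (1 - d * x) * w)"
  proof -
    have "antidiff q s b d (Suc m) =
      qpoch (s\<^sup>2 * q) q (Suc m) * qpoch (b * q) q (Suc m) * qpoch (d * q) q (Suc m) / M * w ^ Suc m"
      by (simp only: antidiff_def M w_def)
    moreover have "qpoch (s\<^sup>2 * q) q (Suc m) * qpoch (b * q) q (Suc m) * qpoch (d * q) q (Suc m)
      = N * ((1 - s\<^sup>2 * x) * (1 - b * x) * (1 - d * x))"
      by (simp add: qpoch_Suc N_def x_def mult_ac)
    ultimately show ?thesis by (simp add: K_def mult_ac)
  qed

  have antidiff: "antidiff q s b d m =
      K * ((1 - x) * (1 - s\<^sup>2 * x / b) * (1 - s\<^sup>2 * x / d))"
  proof -
    define u where "u = (1 - x) * (1 - s\<^sup>2 * x / b) * (1 - s\<^sup>2 * x / d)"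
    have M': "M = qpoch q q m * qpoch (s\<^sup>2 * q / b) q m * qpoch (s\<^sup>2 * q / d) q m * u"
      unfolding M Qr Br Dr u_def by (simp only: mult_ac)
    have "u \<noteq> 0" using Q B D by (simp add: Qr Br Dr u_def)
    then have "K * u = N / (qpoch q q m * qpoch (s\<^sup>2 * q / b) q m * qpoch (s\<^sup>2 * q / d) q m) * w ^ m"
      by (simp add: K_def M')
    then show ?thesis by (simp add: antidiff_def N_def u_def w_def)
  qed

  have summand: "summand q s b d (Suc m) =
      K * ((1 - s) * (1 - b) * (1 - d) * (1 + s * x) * (w * x))"
  proof -
    have ratio: "qpoch (- q * s) q (Suc m) / qpoch (- s) q (Suc m) = (1 + s * x) / (1 + s)"
      using qpoch_ratio[OF S] Snz(1) by (simp add: x_def field_simps)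
    have "(q * s / (b * d)) ^ Suc m = w ^ m * (w * x)"
      by (simp add: w_def x_def power_mult_distrib power_divide mult_ac)
    moreover have "qpoch (s\<^sup>2) q (Suc m) * qpoch b q (Suc m) * qpoch d q (Suc m) =
        N * ((1 - s) * (1 + s) * (1 - b) * (1 - d))"
      by (simp add: qpoch_Suc_shift N_def power2_eq_square algebra_simps)
    moreover have "summand q s b d (Suc m) =
        (qpoch (s\<^sup>2) q (Suc m) * qpoch b q (Suc m) * qpoch d q (Suc m)) / M
        * (qpoch (- q * s) q (Suc m) / qpoch (- s) q (Suc m)) * (q * s / (b * d)) ^ Suc m"
      by (simp only: summand_def M times_divide_times_eq mult_ac)
    ultimately have "summand q s b d (Suc m) =
        N * ((1 - s) * (1 + s) * (1 - b) * (1 - d)) / M * ((1 + s * x) / (1 + s))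
        * (w ^ m * (w * x))"
      by (simp only: ratio)
    then show ?thesis using Snz(1) by (simp add: K_def mult_ac)
  qed

  have shifted: "shift_factor q s b d * summand q (s * q) (b * q) (d * q) m =
      K * ((1 - x) * (1 - s\<^sup>2 * x) * (1 + s * x) * (1 - w))"
  proof -
    have ratio: "(1 + s * q) * (qpoch (- q * (s * q)) q m / qpoch (- (s * q)) q m) = 1 + s * x"
      using qpoch_ratio[OF Snz(2)] by (simp add: x_def mult_ac)
    have args: "(s * q)\<^sup>2 * q / (b * q) = s\<^sup>2 * q / b * q" "(s * q)\<^sup>2 * q / (d * q) = s\<^sup>2 * q / d * q"
      "q * (s * q) / (b * q * (d * q)) = w"
      using nz by (simp_all add: w_def power2_eq_square)
    have num: "(1 - s\<^sup>2 * q) * qpoch ((s * q)\<^sup>2) q m = qpoch (s\<^sup>2 * q) q m * (1 - s\<^sup>2 * x)"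
      using qpoch_Suc[of "s\<^sup>2 * q" q m] qpoch_Suc_shift[of "s\<^sup>2 * q" q m]
      by (simp add: x_def power2_eq_square mult_ac)
    have x1: "1 - x \<noteq> 0" using Q by (simp add: Qr)
    have "shift_factor q s b d * summand q (s * q) (b * q) (d * q) m =
        ((1 - s\<^sup>2 * q) * qpoch ((s * q)\<^sup>2) q m) * qpoch (b * q) q m * qpoch (d * q) q m * w ^ m
        * ((1 + s * q) * (qpoch (- q * (s * q)) q m / qpoch (- (s * q)) q m)) * (1 - w)
        / (qpoch q q m * ((1 - s\<^sup>2 * q / b) * E) * ((1 - s\<^sup>2 * q / d) * F))"
      unfolding shift_factor_def summand_def args E_def[symmetric] F_def[symmetric]
        w_def[symmetric]
      by (simp add: mult_ac)
    also have "\<dots> = N * w ^ m * ((1 - s\<^sup>2 * x) * (1 + s * x) * (1 - w))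
        / (qpoch q q m * ((1 - s\<^sup>2 * q / b) * E) * ((1 - s\<^sup>2 * q / d) * F))"
      unfolding num ratio N_def by (simp only: mult_ac)
    also have "\<dots> = K * ((1 - x) * (1 - s\<^sup>2 * x) * (1 + s * x) * (1 - w))"
      using x1 by (simp add: K_def M_def Qr mult_ac)
    finally show ?thesis .
  qed

  show ?thesis
    unfolding summand antidiff_Suc antidiff shifted telescoping_identity[OF nz(2,3) w_def]
    by (simp only: distrib_left right_diff_distrib)
qed

lemma sum_summand_Suc:
  assumes "q \<noteq> 0" "b \<noteq> 0" "d \<noteq> 0"
    and "qpoch q q (Suc n) \<noteq> 0" "qpoch (- s) q (Suc n) \<noteq> 0"
    and "qpoch (s\<^sup>2 * q / b) q (Suc n) \<noteq> 0" "qpoch (s\<^sup>2 * q / d) q (Suc n) \<noteq> 0"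
  shows "(\<Sum>j\<le>Suc n. summand q s b d j) = antidiff q s b d (Suc n)
           + shift_factor q s b d * (\<Sum>j\<le>n. summand q (s * q) (b * q) (d * q) j)"
proof -
  have "(\<Sum>j\<le>Suc n. summand q s b d j) = 1 + (\<Sum>j\<le>n. summand q s b d (Suc j))"
    by (subst sum.atMost_Suc_shift) (simp add: summand_def)
  also have "(\<Sum>j\<le>n. summand q s b d (Suc j)) =
      (\<Sum>j\<le>n. antidiff q s b d (Suc j) - antidiff q s b d j
        + shift_factor q s b d * summand q (s * q) (b * q) (d * q) j)"
    by (intro sum.cong refl summand_Suc assms(1-3); rule qpoch_nonzero_le)
      (use assms in auto)
  also have "\<dots> = antidiff q s b d (Suc n) - 1
      + shift_factor q s b d * (\<Sum>j\<le>n. summand q (s * q) (b * q) (d * q) j)"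
    by (simp only: sum.distrib sum_distrib_left lessThan_Suc_atMost[symmetric]
        sum_lessThan_telescope) (simp add: antidiff_def)
  finally show ?thesis by simp
qed

lemma sum_summand:
  assumes "q \<noteq> 0" "b \<noteq> 0"
    and "qpoch q q n \<noteq> 0" "qpoch (- s) q n \<noteq> 0"
    and "qpoch (s\<^sup>2 * q / b) q n \<noteq> 0" "qpoch (s\<^sup>2 * q ^ Suc n) q n \<noteq> 0"
    and "qpoch (q * s) q n \<noteq> 0"
  shows "(\<Sum>j\<le>n. summand q s b (1 / q ^ n) j) =
    qpoch (s\<^sup>2 * q) q n * qpoch (q * s / b) q n / (qpoch (q * s) q n * qpoch (s\<^sup>2 * q / b) q n)"
  using assms
proof (induction n arbitrary: s b)
  case 0
  then show ?case by (simp add: summand_def)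
next
  case (Suc n)
  let ?d = "1 / q ^ Suc n"
  have d: "?d \<noteq> 0" "?d * q = 1 / q ^ n" "s\<^sup>2 * q / ?d = s\<^sup>2 * q ^ Suc (Suc n)"
    "s / (b * ?d) = q * s / b * q ^ n"
    using Suc.prems(1,2) by (simp_all add: field_simps)
  have shift: "(s * q)\<^sup>2 * q / (b * q) = s\<^sup>2 * q / b * q" "q * (s * q) / (b * q) = q * s / b"
    "(s * q)\<^sup>2 * q ^ Suc n = s\<^sup>2 * q ^ Suc (Suc n) * q" "(s * q)\<^sup>2 * q = s\<^sup>2 * q * q * q"
    "q * (s * q) = q * s * q"
    using Suc.prems(1,2) by (simp_all add: field_simps power2_eq_square)
  have nz: "qpoch q q n \<noteq> 0" "qpoch (- s * q) q n \<noteq> 0"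
    "1 - s\<^sup>2 * q / b \<noteq> 0" "qpoch (s\<^sup>2 * q / b * q) q n \<noteq> 0"
    "1 - s\<^sup>2 * q ^ Suc (Suc n) \<noteq> 0" "qpoch (s\<^sup>2 * q ^ Suc (Suc n) * q) q n \<noteq> 0"
    "1 - q * s \<noteq> 0" "qpoch (q * s * q) q n \<noteq> 0"
    using Suc.prems(3) qpoch_nonzero_le[of q q "Suc n" n] Suc.prems(4-7)
    by (simp_all only: qpoch_Suc_shift mult_eq_0_iff de_Morgan_disj) auto
  have IH: "(\<Sum>j\<le>n. summand q (s * q) (b * q) (1 / q ^ n) j) =
      qpoch (s\<^sup>2 * q * q * q) q n * qpoch (q * s / b) q n
      / (qpoch (q * s * q) q n * qpoch (s\<^sup>2 * q / b * q) q n)"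
    using Suc.IH[of "b * q" "s * q"] Suc.prems(1,2) nz by (simp only: shift) simp
  \<comment> \<open>\<open>?d * q\<close> is \<open>q\<^sup>-\<^sup>n\<close>, so the last of the \<open>n + 1\<close> factors is 0.\<close>
  have "qpoch (?d * q) q (Suc n) = 0"
    using Suc.prems(1) unfolding d(2) by (simp add: qpoch_Suc)
  then have "antidiff q s b ?d (Suc n) = 0"
    by (simp only: antidiff_def) simp
  then have sum: "(\<Sum>j\<le>Suc n. summand q s b ?d j) = shift_factor q s b ?d *
      (\<Sum>j\<le>n. summand q (s * q) (b * q) (1 / q ^ n) j)"
    using sum_summand_Suc[of q b ?d n s] Suc.prems d(1) by (simp only: d) simp
  have num: "(1 - s\<^sup>2 * q) * ((1 - q * s) * (1 + s * q)) * qpoch (s\<^sup>2 * q * q * q) q n =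
      qpoch (s\<^sup>2 * q) q (Suc n) * (1 - s\<^sup>2 * q ^ Suc (Suc n))"
  proof -
    have "(1 - q * s) * (1 + s * q) = 1 - s\<^sup>2 * q * q"
      by (simp add: algebra_simps power2_eq_square)
    then show ?thesis
      using qpoch_Suc[of "s\<^sup>2 * q" q "Suc n"] qpoch_Suc_shift[of "s\<^sup>2 * q" q "Suc n"]
        qpoch_Suc_shift[of "s\<^sup>2 * q * q" q n] by (simp add: mult_ac)
  qed
  have "shift_factor q s b ?d * (\<Sum>j\<le>n. summand q (s * q) (b * q) (1 / q ^ n) j) =
     ((1 - s\<^sup>2 * q) * ((1 - q * s) * (1 + s * q)) * qpoch (s\<^sup>2 * q * q * q) q n)
      * (qpoch (q * s / b) q n * (1 - q * s / b * q ^ n))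
     / ((1 - s\<^sup>2 * q ^ Suc (Suc n)) * ((1 - q * s) * qpoch (q * s * q) q n)
        * ((1 - s\<^sup>2 * q / b) * qpoch (s\<^sup>2 * q / b * q) q n))"
    unfolding IH shift_factor_def d using nz(7) by (simp add: mult_ac)
  also have "\<dots> = qpoch (s\<^sup>2 * q) q (Suc n) * (1 - s\<^sup>2 * q ^ Suc (Suc n)) * qpoch (q * s / b) q (Suc n)
     / ((1 - s\<^sup>2 * q ^ Suc (Suc n)) * qpoch (q * s) q (Suc n) * qpoch (s\<^sup>2 * q / b) q (Suc n))"
    by (simp only: num qpoch_Suc[of "q * s / b", symmetric] qpoch_Suc_shift[symmetric])
  also have "\<dots> = qpoch (s\<^sup>2 * q) q (Suc n) * qpoch (q * s / b) q (Suc n)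
     / (qpoch (q * s) q (Suc n) * qpoch (s\<^sup>2 * q / b) q (Suc n))"
    using nz(5) by (simp del: power_Suc)
  finally show ?case unfolding sum .
qed

theorem theorem1p4:
  fixes n :: nat and q a b sqrt_a :: complex
  assumes "q \<noteq> 0" and "a \<noteq> 0" and "b \<noteq> 0"
    and "sqrt_a ^ 2 = a"
    and "\<And>j. j \<le> n \<Longrightarrow> qpochs [q, - sqrt_a, a * q / b, a * q ^ (n + 1)] q j \<noteq> 0"
    and "qpochs [q * sqrt_a, a * q / b] q n \<noteq> 0"
  shows "bhyp [a, - q * sqrt_a, b, q powi (- int n)]
              [- sqrt_a, a * q / b, a * q ^ (n + 1)] q (q ^ (n + 1) * sqrt_a / b)
       = qpochs [a * q, q * sqrt_a / b] q n / qpochs [q * sqrt_a, a * q / b] q n"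
proof -
  have d: "q powi (- int n) = 1 / q ^ n"
    by (simp add: power_int_minus divide_inverse)
  have args: "a * q / (1 / q ^ n) = a * q ^ (n + 1)"
    "q * sqrt_a / (b * (1 / q ^ n)) = q ^ (n + 1) * sqrt_a / b"
    by (simp_all add: mult_ac)
  have "bhyp [a, - q * sqrt_a, b, q powi (- int n)]
          [- sqrt_a, a * q / b, a * q ^ (n + 1)] q (q ^ (n + 1) * sqrt_a / b)
      = (\<Sum>j\<le>n. summand q sqrt_a b (1 / q ^ n) j)"
    unfolding summand_def assms(4) args
    by (subst bhyp_terminating[OF assms(1), of n]) (simp_all add: d qpochs_def mult.assoc)
  also have "\<dots> = qpoch (a * q) q n * qpoch (q * sqrt_a / b) q n
      / (qpoch (q * sqrt_a) q n * qpoch (a * q / b) q n)"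
    using sum_summand[of q b n sqrt_a] assms(1,3,4) assms(5)[of n] assms(6)
    by (simp add: qpochs_def)
  finally show ?thesis by (simp add: qpochs_def)
qed

end
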